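(* Let $n$ be a nonnegative integer. Then $$\sum_{k=0}^n \frac{q^{n-k}\,(-q;q)_{n+1}^2}{(1+q)\,(-q;q)_k^2\,(-q;q)_{n-k}\,(-q;q)_{n-k+1}}\, T_{k,0}(q)\, T_{n-k,1}(q) = T_{n+1,0}(q).$$
   Context: $q$ is an indeterminate; identities are in the field of rational functions in $q$. $(a;q)_0=1$ and $(a;q)_n=\prod_{k=0}^{n-1}(1-aq^k)$ for $n\ge 1$. $[i]_q=\frac{1-q^i}{1-q}$ and $[k]_q!=\prod_{i=1}^k [i]_q$. The $q$-super Catalan numbers are, for nonnegative integers $n,m$, $T_{n,m}(q)=\frac{[2m]_q!\,[2n]_q!}{[m]_q!\,[n]_q!\,[m+n]_q!}$. *)

theory Defs
  imports "HOL-Computational_Algebra.Computational_Algebra"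
begin

text \<open>
  The field of rational functions over a field \<open>'a\<close> is \<open>'a poly fract\<close>. The \<open>q\<close>-analogues take
  \<open>q\<close> as an element of an arbitrary field. With Isabelle's convention \<open>x / 0 = 0\<close> they have
  the intended meaning only where the denominators are nonzero; this is so at the indeterminate,
  which is not a root of unity.
\<close>

definition indeterminate :: "'a::field poly fract" where
  "indeterminate = Fract [:0, 1:] 1"

definition q_pochhammer :: "'b::field \<Rightarrow> 'b \<Rightarrow> nat \<Rightarrow> 'b" where
  "q_pochhammer a q n = (\<Prod>k<n. 1 - a * q ^ k)"

definition q_int :: "'b::field \<Rightarrow> nat \<Rightarrow> 'b" where
  "q_int q i = (1 - q ^ i) / (1 - q)"

definition q_fact :: "'b::field \<Rightarrow> nat \<Rightarrow> 'b" where
  "q_fact q k = (\<Prod>i=1..k. q_int q i)"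

definition q_super_catalan :: "'b::field \<Rightarrow> nat \<Rightarrow> nat \<Rightarrow> 'b" where
  "q_super_catalan q n m =
     (q_fact q (2 * m) * q_fact q (2 * n)) / (q_fact q m * q_fact q n * q_fact q (m + n))"

end

theory Submission
  imports Defs
begin

text \<open>
  Put \<open>a\<^sub>k = (q;q\<^sup>2)\<^sub>k / (q\<^sup>2;q\<^sup>2)\<^sub>k\<close>. Then \<open>T\<^sub>k\<^sub>,\<^sub>0 = (-q;q)\<^sub>k\<^sup>2 a\<^sub>k\<close> and
  \<open>[k+1] T\<^sub>k\<^sub>,\<^sub>1 = (1+q) T\<^sub>k\<^sub>,\<^sub>0\<close>, so that the claim reduces to a convolution identity for \<open>a\<close>. As the
  generating function of \<open>a\<close> is \<open>(qx;q\<^sup>2)\<^sub>\<infinity> / (x;q\<^sup>2)\<^sub>\<infinity>\<close>, this identity compares coefficients in the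
  product of that series with its inverse. The convolution is summable in
  closed form at every intermediate index, so it follows by telescoping.
\<close>

text \<open>The \<open>a\<^sub>k\<close> above, a q-analogue of binomial(2k, k) / 4^k.\<close>

definition q_central :: "'b::field \<Rightarrow> nat \<Rightarrow> 'b" where
  "q_central q k = (\<Prod>i<k. (1 - q ^ (2 * i + 1)) / (1 - q ^ (2 * i + 2)))"

lemma q_central_0 [simp]: "q_central q 0 = 1"
  by (simp add: q_central_def)

lemma q_central_Suc:
  "q_central q (Suc k) = q_central q k * ((1 - q ^ (2 * k + 1)) / (1 - q ^ (2 * k + 2)))"
  by (simp add: q_central_def)

lemma q_fact_0 [simp]: "q_fact q 0 = 1"
  by (simp add: q_fact_def)

lemma q_fact_Suc: "q_fact q (Suc k) = q_fact q k * q_int q (Suc k)"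
  by (simp add: q_fact_def)

lemma q_pochhammer_0 [simp]: "q_pochhammer a q 0 = 1"
  by (simp add: q_pochhammer_def)

lemma q_pochhammer_Suc: "q_pochhammer a q (Suc n) = q_pochhammer a q n * (1 - a * q ^ n)"
  by (simp add: q_pochhammer_def)

lemma indeterminate_power:
  "(indeterminate :: 'a::field poly fract) ^ i = Fract (monom 1 i) 1"
proof (induction i)
  case 0
  show ?case by (simp add: One_fract_def)
next
  case (Suc i)
  have "[:0, 1:] * monom 1 i = (monom 1 (Suc i) :: 'a poly)"
    by (simp add: monom_Suc)
  with Suc show ?case by (simp add: indeterminate_def)
qed

text \<open>Comparing degrees shows that the indeterminate meets the hypothesis under which the
  identities below are proved, which keeps their denominators nonzero.\<close>

lemma indeterminate_power_neq_1:
  assumes "i > 0"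
  shows "(indeterminate :: 'a::field poly fract) ^ i \<noteq> 1"
proof
  assume "(indeterminate :: 'a poly fract) ^ i = 1"
  then have "(monom 1 i :: 'a poly) = 1"
    by (simp add: indeterminate_power One_fract_def eq_fract)
  then have "degree (monom 1 i :: 'a poly) = degree (1 :: 'a poly)"
    by (rule arg_cong)
  with assms show False by (simp add: degree_monom_eq)
qed

context
  fixes q :: "'b::field"
  assumes not_root_of_unity: "\<And>i. i > 0 \<Longrightarrow> q ^ i \<noteq> 1"
begin

lemma one_minus_power_nonzero: "i > 0 \<Longrightarrow> 1 - q ^ i \<noteq> 0"
  using not_root_of_unity[of i] by auto

text \<open>It is a factor of \<open>1 - q ^ (2 * i)\<close>.\<close>

lemma one_plus_power_nonzero: "i > 0 \<Longrightarrow> 1 + q ^ i \<noteq> 0"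
proof -
  assume "i > 0"
  then have "(1 - q ^ i) * (1 + q ^ i) \<noteq> 0"
    using one_minus_power_nonzero[of "i + i"] by (simp add: power_add algebra_simps)
  then show ?thesis by simp
qed

lemma q_pochhammer_minus_nonzero: "q_pochhammer (- q) q k \<noteq> 0"
proof (induction k)
  case (Suc k)
  then show ?case using one_plus_power_nonzero[of "Suc k"] by (simp add: q_pochhammer_Suc)
qed simp

lemma q_super_catalan_0: "q_super_catalan q k 0 = (q_pochhammer (- q) q k)\<^sup>2 * q_central q k"
proof (induction k)
  case 0
  show ?case by (simp add: q_super_catalan_def)
next
  case (Suc k)
  have nz: "1 - q \<noteq> 0" "1 - q ^ (k + 1) \<noteq> 0" "1 + q ^ (k + 1) \<noteq> 0"
    using one_minus_power_nonzero[of 1] one_minus_power_nonzero[of "k + 1"]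
      one_plus_power_nonzero[of "k + 1"] by simp_all
  have fac: "1 - q ^ (2 * k + 2) = (1 - q ^ (k + 1)) * (1 + q ^ (k + 1))"
    by (simp add: algebra_simps flip: power_add mult_2)
  have "q_super_catalan q (Suc k) 0
      = q_super_catalan q k 0 * (q_int q (2 * k + 1) * q_int q (2 * k + 2) / (q_int q (k + 1))\<^sup>2)"
    by (simp add: q_super_catalan_def q_fact_Suc power2_eq_square ac_simps)
  \<comment> \<open>The ratio of consecutive terms. By \<open>fac\<close>, expanding by
    \<open>1 - q ^ (2 * k + 2)\<close> turns the denominator
    \<open>(1 - q ^ (k + 1))\<^sup>2\<close> into the square of \<open>1 + q ^ (k + 1)\<close> in
    the numerator.\<close>
  also have "q_int q (2 * k + 1) * q_int q (2 * k + 2) / (q_int q (k + 1))\<^sup>2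
      = (1 + q ^ (k + 1))\<^sup>2 * ((1 - q ^ (2 * k + 1)) / (1 - q ^ (2 * k + 2)))"
    unfolding q_int_def fac using nz by (simp add: divide_simps power2_eq_square)
  finally show ?case
    by (simp add: Suc q_pochhammer_Suc q_central_Suc power2_eq_square)
qed

text \<open>Passing from m = 0 to m = 1 brings in [2]!/[1]! = 1 + q and replaces one [j]! in the
  denominator by [j+1]!.\<close>

lemma q_super_catalan_1:
  "q_super_catalan q j 1 = (1 + q) * q_super_catalan q j 0 / q_int q (j + 1)"
proof -
  have "1 - q \<noteq> 0" using one_minus_power_nonzero[of 1] by simp
  moreover have "1 - q\<^sup>2 = (1 - q) * (1 + q)"
    by (simp add: algebra_simps power2_eq_square)
  ultimately have "q_int q 1 = 1" "q_int q 2 = 1 + q"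
    by (simp_all add: q_int_def)
  then have "q_fact q 1 = 1" "q_fact q 2 = 1 + q"
    using q_fact_Suc[of q 0] q_fact_Suc[of q 1] by (simp_all add: numeral_2_eq_2)
  then show ?thesis
    by (simp add: q_super_catalan_def q_fact_Suc)
qed

lemma q_central_convolution_partial:
  assumes "m \<le> n"
  shows "(\<Sum>k\<le>m. q ^ (n - k) * q_central q k * q_central q (n - k) * (1 - q)
                    / (1 - q ^ (2 * (n - k) + 2)))
       = q ^ (n - m) * q_central q m * q_central q (n - m) * (1 - q ^ (2 * m + 1))
           / (1 - q ^ (2 * n + 2))"
  using assms
proof (induction m)
  case 0
  then show ?case by simp
next
  case (Suc m)
  define j where "j = n - Suc m"
  have n: "n = m + j + 1" and nm: "n - m = Suc j"
    using Suc.prems by (auto simp: j_def)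
  \<comment> \<open>In terms of \<open>q\<close>, \<open>u\<close> and \<open>v\<close> all
    exponents are numerals, so the induction step becomes a polynomial identity.\<close>
  define u where "u = q ^ (2 * m)"
  define v where "v = q ^ (2 * j)"
  have pw: "q ^ (2 * m + 1) = q * u" "q ^ (2 * m + 2) = q\<^sup>2 * u" "q ^ (2 * Suc m + 1) = q ^ 3 * u"
    "q ^ (2 * j + 1) = q * v" "q ^ (2 * j + 2) = q\<^sup>2 * v" "q ^ (2 * n + 2) = q ^ 4 * u * v"
    unfolding u_def v_def n by (simp_all add: algebra_simps power_add eval_nat_numeral)
  have nz: "1 - q\<^sup>2 * u \<noteq> 0" "1 - q\<^sup>2 * v \<noteq> 0" "1 - q ^ 4 * u * v \<noteq> 0"
    using one_minus_power_nonzero[of "2 * m + 2"] one_minus_power_nonzero[of "2 * j + 2"]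
      one_minus_power_nonzero[of "2 * n + 2"] by (simp_all only: pw) auto
  define X where "X = q ^ j * q_central q m * q_central q j"
  have "(\<Sum>k\<le>Suc m. q ^ (n - k) * q_central q k * q_central q (n - k) * (1 - q)
                    / (1 - q ^ (2 * (n - k) + 2)))
     = q ^ Suc j * q_central q m * q_central q (Suc j) * (1 - q ^ (2 * m + 1))
           / (1 - q ^ (2 * n + 2))
       + q ^ j * q_central q (Suc m) * q_central q j * (1 - q) / (1 - q ^ (2 * j + 2))"
    using Suc by (simp add: nm flip: j_def)
  also have "\<dots> = X * (1 - q * u) *
      (q * (1 - q * v) / ((1 - q\<^sup>2 * v) * (1 - q ^ 4 * u * v))
       + (1 - q) / ((1 - q\<^sup>2 * u) * (1 - q\<^sup>2 * v)))"
    unfolding q_central_Suc pw X_def by (simp add: algebra_simps)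
  also have "q * (1 - q * v) / ((1 - q\<^sup>2 * v) * (1 - q ^ 4 * u * v))
       + (1 - q) / ((1 - q\<^sup>2 * u) * (1 - q\<^sup>2 * v))
      = (1 - q ^ 3 * u) / ((1 - q\<^sup>2 * u) * (1 - q ^ 4 * u * v))"
  proof -
    \<comment> \<open>The numerator over the common denominator; its factor
      \<open>1 - q\<^sup>2 * v\<close> cancels, leaving the closed form for
      \<open>Suc m\<close>.\<close>
    have "q * (1 - q * v) * (1 - q\<^sup>2 * u) + (1 - q) * (1 - q ^ 4 * u * v)
        = (1 - q ^ 3 * u) * (1 - q\<^sup>2 * v)"
      by algebra
    then show ?thesis
      using nz by (simp add: divide_simps ac_simps)
  qed
  also have "X * (1 - q * u) * ((1 - q ^ 3 * u) / ((1 - q\<^sup>2 * u) * (1 - q ^ 4 * u * v)))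
      = q ^ j * q_central q (Suc m) * q_central q j * (1 - q ^ (2 * Suc m + 1))
           / (1 - q ^ (2 * n + 2))"
    unfolding q_central_Suc pw X_def by simp
  finally show ?case by (simp only: j_def)
qed

text \<open>With j = n - k, the cofactor of \<open>q_central q k\<close> is minus the coefficient of
  x^(j+1) in the inverse series, whose constant term is 1. Thus the coefficient of x^(n+1) in the
  product vanishes.\<close>

lemma q_central_convolution:
  "(\<Sum>k\<le>n. q ^ (n - k) * q_central q k * q_central q (n - k) * (1 - q)
                    / (1 - q ^ (2 * (n - k) + 2)))
     = q_central q (Suc n)"
  using q_central_convolution_partial[of n n] by (simp add: q_central_Suc)

lemma q_super_catalan_convolution:
  "(\<Sum>k=0..n.
      q ^ (n - k) * (q_pochhammer (- q) q (n + 1))\<^sup>2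
        / ((1 + q) * (q_pochhammer (- q) q k)\<^sup>2
             * q_pochhammer (- q) q (n - k) * q_pochhammer (- q) q (n - k + 1))
      * q_super_catalan q k 0 * q_super_catalan q (n - k) 1)
   = q_super_catalan q (n + 1) 0"
  (is "(\<Sum>k=0..n. ?s k) = _")
proof -
  let ?t = "\<lambda>k. q ^ (n - k) * q_central q k * q_central q (n - k) * (1 - q)
                    / (1 - q ^ (2 * (n - k) + 2))"
  \<comment> \<open>The squares of (-q;q)_k and (-q;q)_j cancel. The remaining
    \<open>1 + q ^ (j + 1)\<close> joins the \<open>1 - q ^ (j + 1)\<close> from [j+1] to form
    \<open>1 - q ^ (2 * j + 2)\<close>.\<close>
  have "?s k = (q_pochhammer (- q) q (n + 1))\<^sup>2 * ?t k" for k
  proof -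
    define j where "j = n - k"
    have nz: "1 + q \<noteq> 0" "1 + q ^ (j + 1) \<noteq> 0" "1 - q ^ (j + 1) \<noteq> 0" "1 - q \<noteq> 0"
      "q_pochhammer (- q) q k \<noteq> 0" "q_pochhammer (- q) q j \<noteq> 0"
      using one_plus_power_nonzero[of 1] one_plus_power_nonzero[of "j + 1"]
        one_minus_power_nonzero[of "j + 1"] one_minus_power_nonzero[of 1]
        q_pochhammer_minus_nonzero by simp_all
    have fac: "1 - q ^ (2 * j + 2) = (1 - q ^ (j + 1)) * (1 + q ^ (j + 1))"
      by (simp add: algebra_simps flip: power_add mult_2)
    have poch: "q_pochhammer (- q) q (j + 1) = q_pochhammer (- q) q j * (1 + q ^ (j + 1))"
      by (simp add: q_pochhammer_Suc)
    show ?thesis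
      unfolding q_super_catalan_1 q_super_catalan_0 q_int_def j_def[symmetric] poch fac
      using nz by (simp add: divide_simps power2_eq_square)
  qed
  then have "(\<Sum>k=0..n. ?s k) = (q_pochhammer (- q) q (n + 1))\<^sup>2 * (\<Sum>k\<le>n. ?t k)"
    by (simp add: sum_distrib_left atLeast0AtMost)
  then show ?thesis
    unfolding q_central_convolution q_super_catalan_0[of "n + 1"] by simp
qed

end

theorem proposition6:
  fixes n :: nat and q :: "'a::field_char_0 poly fract"
  assumes "q = indeterminate"
  shows "(\<Sum>k=0..n.
            q ^ (n - k) * (q_pochhammer (- q) q (n + 1))\<^sup>2
              / ((1 + q) * (q_pochhammer (- q) q k)\<^sup>2
                   * q_pochhammer (- q) q (n - k) * q_pochhammer (- q) q (n - k + 1))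
            * q_super_catalan q k 0 * q_super_catalan q (n - k) 1)
         = q_super_catalan q (n + 1) 0"
  using q_super_catalan_convolution[of q] indeterminate_power_neq_1 assms by blast

end
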